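(* Let $1<p<\infty$. The Markov-Stieltjes transform $S$, given by $Sf(z)=\int_0^1\frac{f(t)}{1-tz}\,dt$ for $f\in\ell^p_A$, $z\in\mathbb{D}$, is a bounded Hankel operator on $\ell^p_A$, and its matrix with respect to the standard basis $e_n(z)=z^n$ ($n\in\mathbb{Z}_+$) is the Hilbert matrix $\left(\frac{1}{n+m+1}\right)_{m,n=0}^\infty$. Moreover, $$\|S\|_{\ell^p_A\to\ell^p_A}=\frac{\pi}{\sin\frac{\pi}{p}}.$$
   Context: $\mathbb{D}$ is the open unit disk. The Banach space $\ell^p_A$ consists of the functions $f(z)=\sum_{n=0}^\infty f_nz^n$ holomorphic in $\mathbb{D}$ with $\|f\|_{\ell^p_A}^p:=\sum_{n=0}^\infty|f_n|^p<\infty$. The Hankel operator $H(a)$ on $\ell^p_A$ associated with a sequence $a=(a_n)$ is defined by $H(a)f(z)=\sum_{j=0}^\infty b_jz^j$ ($z\in\mathbb{D}$), where $b_j=\sum_{k=0}^\infty a_{k+j+1}f_k$ for $f(z)=\sum_{n=0}^\infty f_nz^n$. In the integral defining $Sf$, $f$ is restricted to $(0,1)\subset\mathbb{D}$. *)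

theory Defs
  imports "HOL-Complex_Analysis.Complex_Analysis"
begin

abbreviation unit_disc :: "complex set" where
  "unit_disc \<equiv> ball 0 1"

definition taylor_coeff :: "(complex \<Rightarrow> complex) \<Rightarrow> nat \<Rightarrow> complex" where
  "taylor_coeff f n = fps_nth (fps_expansion f 0) n"

(* A function on the disc is represented by its extension by 0 to the whole plane, so that
   equality of elements of lpA is equality of functions on the disc. *)
definition lpA :: "real \<Rightarrow> (complex \<Rightarrow> complex) set" where
  "lpA p = {f. f holomorphic_on unit_disc \<and> (\<forall>z. z \<notin> unit_disc \<longrightarrow> f z = 0) \<and>
               summable (\<lambda>n. norm (taylor_coeff f n) powr p)}"

definition lpA_norm :: "real \<Rightarrow> (complex \<Rightarrow> complex) \<Rightarrow> real" where
  "lpA_norm p f = (\<Sum>n. norm (taylor_coeff f n) powr p) powr (1 / p)"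

definition bounded_operator ::
    "real \<Rightarrow> ((complex \<Rightarrow> complex) \<Rightarrow> (complex \<Rightarrow> complex)) \<Rightarrow> bool" where
  "bounded_operator p T \<longleftrightarrow>
     (\<forall>f\<in>lpA p. T f \<in> lpA p) \<and>
     (\<forall>f\<in>lpA p. \<forall>g\<in>lpA p. T (\<lambda>z. f z + g z) = (\<lambda>z. T f z + T g z)) \<and>
     (\<forall>f\<in>lpA p. \<forall>c. T (\<lambda>z. c * f z) = (\<lambda>z. c * T f z)) \<and>
     (\<exists>C. \<forall>f\<in>lpA p. lpA_norm p (T f) \<le> C * lpA_norm p f)"

(* The supremum is meaningful only for operators satisfying bounded_operator. *)
definition operator_norm ::
    "real \<Rightarrow> ((complex \<Rightarrow> complex) \<Rightarrow> (complex \<Rightarrow> complex)) \<Rightarrow> real" where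
  "operator_norm p T = (SUP f\<in>{f \<in> lpA p. lpA_norm p f \<le> 1}. lpA_norm p (T f))"

definition hankel_coeff :: "(nat \<Rightarrow> complex) \<Rightarrow> (complex \<Rightarrow> complex) \<Rightarrow> nat \<Rightarrow> complex" where
  "hankel_coeff a f j = (\<Sum>k. a (k + j + 1) * taylor_coeff f k)"

definition hankel_op :: "(nat \<Rightarrow> complex) \<Rightarrow> (complex \<Rightarrow> complex) \<Rightarrow> complex \<Rightarrow> complex" where
  "hankel_op a f z = (if z \<in> unit_disc then (\<Sum>j. hankel_coeff a f j * z ^ j) else 0)"

(* The two summability clauses say that the series defining hankel_op a f converge. *)
definition hankel_operator ::
    "real \<Rightarrow> ((complex \<Rightarrow> complex) \<Rightarrow> (complex \<Rightarrow> complex)) \<Rightarrow> bool" where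
  "hankel_operator p T \<longleftrightarrow>
     (\<exists>a. \<forall>f\<in>lpA p.
        (\<forall>j. summable (\<lambda>k. a (k + j + 1) * taylor_coeff f k)) \<and>
        (\<forall>z\<in>unit_disc. summable (\<lambda>j. hankel_coeff a f j * z ^ j)) \<and>
        T f = hankel_op a f)"

definition std_basis :: "nat \<Rightarrow> complex \<Rightarrow> complex" where
  "std_basis n z = (if z \<in> unit_disc then z ^ n else 0)"

(* Column n of the matrix consists of the coordinates of T e_n: the series
   M 0 n * e_0 + M 1 n * e_1 + ... converges to T e_n in the norm of lpA p. *)
definition has_matrix ::
    "real \<Rightarrow> ((complex \<Rightarrow> complex) \<Rightarrow> (complex \<Rightarrow> complex)) \<Rightarrow> (nat \<Rightarrow> nat \<Rightarrow> complex) \<Rightarrow> bool" where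
  "has_matrix p T M \<longleftrightarrow>
     (\<forall>n. (\<lambda>N. lpA_norm p (\<lambda>z. T (std_basis n) z - (\<Sum>m<N. M m n * std_basis m z)))
            \<longlonglongrightarrow> 0)"

definition hilbert_matrix :: "nat \<Rightarrow> nat \<Rightarrow> complex" where
  "hilbert_matrix m n = 1 / of_nat (n + m + 1)"

definition markov_stieltjes :: "(complex \<Rightarrow> complex) \<Rightarrow> complex \<Rightarrow> complex" where
  "markov_stieltjes f z =
     (if z \<in> unit_disc
      then (LINT t:{0<..<1}|lborel. f (complex_of_real t) / (1 - complex_of_real t * z))
      else 0)"

end

theory Submission
  imports Defs
begin

text \<open>Expanding \<open>f\<close> and \<open>1 / (1 - t z)\<close> into power series and integrating term by term shows
  that the \<open>j\<close>-th coefficient of \<open>S f\<close> is \<open>\<integral> t\<^sup>j f(t) dt = \<Sum>k. f\<^sub>k / (k + j + 1)\<close>, so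
  everything reduces to Hilbert's inequality in \<open>\<ell>\<^sup>p\<close> with its sharp constant.

  The upper bound is Schur's test with weight \<open>u\<^sub>s(n) = \<Gamma>(n + s) / (\<Gamma>(s) n!)\<close>, \<open>s = 1 - 1/p\<close>.
  Since \<open>u\<^sub>s(n)\<close> is the \<open>n\<close>-th coefficient of \<open>(1 - t) powr (- s)\<close>, the sum
  \<open>\<Sum>n. u\<^sub>s(n) / (m + n + 1)\<close> is the Beta integral \<open>B(m + 1, 1 - s)\<close>, and log-convexity of \<open>\<Gamma>\<close>
  compares these integrals with the weights; the constant is \<open>\<Gamma>(1/p) \<Gamma>(1 - 1/p) = \<pi> / sin (\<pi>/p)\<close>.

  For the lower bound, the sequences \<open>u\<^sub>s\<close> with \<open>s < 1 - 1/p\<close> lie in \<open>\<ell>\<^sup>p\<close>, and the Hilbert matrix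
  maps \<open>u\<^sub>s\<close> to a sequence that is at least \<open>\<Gamma>(s) \<Gamma>(1 - s) m / (m + 1) u\<^sub>s(m)\<close>. As
  \<open>s \<rightarrow> 1 - 1/p\<close> the norm of \<open>u\<^sub>s\<close> tends to infinity, so that only the tail matters.\<close>

section \<open>Schur's test\<close>

text \<open>Jensen's inequality for the power \<open>p\<close> with unnormalised weights. Young's
  inequality pairs each \<open>y j\<close> with \<open>Y powr (p - 1)\<close>, where
  \<open>Y\<close> is the weighted mean; after weighting and summing, the left side is
  \<open>S * Y powr p\<close>, and subtracting its share \<open>1 / q\<close> leaves the
  claim.\<close>

lemma sum_powr_Jensen:
  fixes w y :: "'a \<Rightarrow> real"
  assumes "1 < p" "finite J" and w: "\<And>j. j \<in> J \<Longrightarrow> 0 \<le> w j" and y: "\<And>j. j \<in> J \<Longrightarrow> 0 \<le> y j"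
  shows "(\<Sum>j\<in>J. w j * y j) powr p \<le> (\<Sum>j\<in>J. w j) powr (p - 1) * (\<Sum>j\<in>J. w j * y j powr p)"
proof (cases "(\<Sum>j\<in>J. w j) = 0")
  case True
  then have "\<forall>j\<in>J. w j = 0"
    using assms by (simp add: sum_nonneg_eq_0_iff)
  then show ?thesis by simp
next
  case False
  define S where "S = (\<Sum>j\<in>J. w j)"
  have S: "0 < S"
    using False w unfolding S_def by (metis order_le_less sum_nonneg)
  define T where "T = (\<Sum>j\<in>J. w j * y j)"
  have T: "0 \<le> T" unfolding T_def using w y by (intro sum_nonneg) auto
  define Y where "Y = T / S"
  have Y: "0 \<le> Y" using S T by (simp add: Y_def)
  define q where "q = p / (p - 1)"
  have q: "1 < q" "1/p + 1/q = 1" and qp: "(p - 1) * q = p"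
    using \<open>1 < p\<close> by (auto simp: q_def field_simps)
  have pt: "y j * Y powr (p - 1) \<le> y j powr p / p + Y powr p / q" if "j \<in> J" for j
    using Youngs_inequality[OF \<open>1 < p\<close> q, of "y j" "Y powr (p - 1)"] y[OF that]
    by (simp add: powr_powr qp)
  have "T * Y powr (p - 1) = (\<Sum>j\<in>J. w j * (y j * Y powr (p - 1)))"
    by (simp add: T_def sum_distrib_right mult.assoc)
  also have "\<dots> \<le> (\<Sum>j\<in>J. w j * (y j powr p / p + Y powr p / q))"
    using pt w by (intro sum_mono mult_left_mono)
  also have "\<dots> = (\<Sum>j\<in>J. w j * y j powr p) / p + S * Y powr p / q"
    by (simp add: S_def sum_distrib_right sum_distrib_left sum.distrib algebra_simps sum_divide_distrib)
  finally have *: "T * Y powr (p - 1) \<le> (\<Sum>j\<in>J. w j * y j powr p) / p + S * Y powr p / q" .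
  have "T * Y powr (p - 1) = S * Y powr p"
  proof (cases "Y = 0")
    case True then show ?thesis using S \<open>1 < p\<close> by (simp add: Y_def)
  next
    case False
    have "T = S * Y" using S by (simp add: Y_def)
    moreover have "Y powr p = Y * Y powr (p - 1)"
      using False Y by (simp add: powr_mult_base)
    ultimately show ?thesis by simp
  qed
  moreover have "S * Y powr p = S * Y powr p / p + S * Y powr p / q"
    using q(2) by (metis add_divide_distrib mult.right_neutral times_divide_eq_right distrib_left)
  ultimately have "S * Y powr p / p \<le> (\<Sum>j\<in>J. w j * y j powr p) / p"
    using * by linarith
  then have **: "S * Y powr p \<le> (\<Sum>j\<in>J. w j * y j powr p)"
    using \<open>1 < p\<close> by (simp add: divide_le_cancel)
  have "T powr p = S powr p * Y powr p"
    using S Y by (simp add: Y_def powr_divide)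
  also have "\<dots> = S powr (p - 1) * (S * Y powr p)"
    using S powr_mult_base[of S "p - 1"] by (simp add: mult_ac)
  also have "\<dots> \<le> S powr (p - 1) * (\<Sum>j\<in>J. w j * y j powr p)"
    by (intro mult_left_mono **) auto
  finally show ?thesis by (simp add: S_def T_def)
qed

text \<open>With \<open>K i j * x j\<close> split as \<open>(K i j * A j) * (x j / A j)\<close>,
  Jensen's inequality and the row bound give a factor \<open>C powr (p - 1)\<close>. Exchanging the
  sums makes the column bound applicable, which gives the last factor \<open>C\<close>.\<close>

lemma schur_test_finite:
  fixes K :: "'a \<Rightarrow> 'b \<Rightarrow> real"
  assumes p: "1 < p" and fin: "finite I" "finite J" and "0 \<le> C"
    and K: "\<And>i j. 0 \<le> K i j" and A: "\<And>j. 0 < A j" and B: "\<And>i. 0 \<le> B i"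
    and x: "\<And>j. 0 \<le> x j"
    and row: "\<And>i. (\<Sum>j\<in>J. K i j * A j) \<le> C * B i"
    and col: "\<And>j. (\<Sum>i\<in>I. K i j * B i powr (p - 1)) \<le> C * A j powr (p - 1)"
  shows "(\<Sum>i\<in>I. (\<Sum>j\<in>J. K i j * x j) powr p) \<le> C powr p * (\<Sum>j\<in>J. x j powr p)"
proof -
  have "(\<Sum>j\<in>J. K i j * x j) powr p \<le> C powr (p - 1) * (\<Sum>j\<in>J. K i j * B i powr (p - 1) * (A j * (x j / A j) powr p))"
    (is "_ \<le> ?R i") for i
  proof -
    have "(\<Sum>j\<in>J. K i j * x j) = (\<Sum>j\<in>J. (K i j * A j) * (x j / A j))"
      using A by (intro sum.cong) (auto simp: less_imp_neq[THEN not_sym])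
    then have "(\<Sum>j\<in>J. K i j * x j) powr p = (\<Sum>j\<in>J. (K i j * A j) * (x j / A j)) powr p" by simp
    also have "\<dots> \<le> (\<Sum>j\<in>J. K i j * A j) powr (p - 1) * (\<Sum>j\<in>J. K i j * A j * (x j / A j) powr p)"
      using K A x by (intro sum_powr_Jensen p fin) (auto intro!: mult_nonneg_nonneg divide_nonneg_nonneg less_imp_le[OF A])
    also have "\<dots> \<le> (C * B i) powr (p - 1) * (\<Sum>j\<in>J. K i j * A j * (x j / A j) powr p)"
      using K A p
      by (intro mult_right_mono powr_mono2 row sum_nonneg) (auto intro!: mult_nonneg_nonneg less_imp_le[OF A])
    also have "\<dots> = ?R i"
      using \<open>0 \<le> C\<close> B by (simp add: powr_mult sum_distrib_left mult_ac)
    finally show ?thesis .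
  qed
  then have "(\<Sum>i\<in>I. (\<Sum>j\<in>J. K i j * x j) powr p) \<le> (\<Sum>i\<in>I. ?R i)"
    by (intro sum_mono)
  also have "\<dots> = C powr (p - 1) * (\<Sum>j\<in>J. (A j * (x j / A j) powr p) * (\<Sum>i\<in>I. K i j * B i powr (p - 1)))"
    unfolding sum_distrib_left by (subst sum.swap) (simp add: mult_ac)
  also have "\<dots> \<le> C powr (p - 1) * (\<Sum>j\<in>J. (A j * (x j / A j) powr p) * (C * A j powr (p - 1)))"
    by (intro mult_left_mono sum_mono col mult_nonneg_nonneg less_imp_le[OF A]) auto
  also have "\<dots> = C powr (p - 1) * (\<Sum>j\<in>J. C * x j powr p)"
  proof -
    have "(A j * (x j / A j) powr p) * (C * A j powr (p - 1)) = C * x j powr p" for j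
    proof -
      have "A j * A j powr (p - 1) = A j powr p"
        using A[of j] powr_mult_base[of "A j" "p - 1"] by simp
      then show ?thesis using A[of j] x[of j] by (simp add: powr_divide field_simps)
    qed
    then show ?thesis by (simp only:)
  qed
  also have "\<dots> = C powr p * (\<Sum>j\<in>J. x j powr p)"
    using \<open>0 \<le> C\<close> powr_mult_base[of C "p - 1"] p
    by (simp add: sum_distrib_left [symmetric] mult.assoc[symmetric])
       (simp add: mult.commute)
  finally show ?thesis .
qed

text \<open>The finite test bounds all finite sections by the same \<open>X\<close>. A single
  partial row sum is therefore at most \<open>X powr (1 / p)\<close>, so the rows converge; then
  first the number of columns and afterwards the number of rows tends to infinity.\<close>

lemma schur_test:
  fixes K :: "nat \<Rightarrow> nat \<Rightarrow> real"
  assumes p: "1 < p" and "0 \<le> C"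
    and K: "\<And>i j. 0 \<le> K i j" and A: "\<And>j. 0 < A j" and B: "\<And>i. 0 \<le> B i"
    and x: "\<And>j. 0 \<le> x j" and sx: "summable (\<lambda>j. x j powr p)"
    and row: "\<And>i N. (\<Sum>j<N. K i j * A j) \<le> C * B i"
    and col: "\<And>j M. (\<Sum>i<M. K i j * B i powr (p - 1)) \<le> C * A j powr (p - 1)"
  shows "summable (\<lambda>j. K i j * x j)"
    and "summable (\<lambda>i. (\<Sum>j. K i j * x j) powr p)"
    and "(\<Sum>i. (\<Sum>j. K i j * x j) powr p) \<le> C powr p * (\<Sum>j. x j powr p)"
proof -
  define X where "X = C powr p * (\<Sum>j. x j powr p)"
  have fin: "(\<Sum>i<M. (\<Sum>j<N. K i j * x j) powr p) \<le> X" for M N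
  proof -
    have "(\<Sum>i<M. (\<Sum>j<N. K i j * x j) powr p) \<le> C powr p * (\<Sum>j<N. x j powr p)"
      by (rule schur_test_finite[where A = A and B = B]) (use assms in auto)
    also have "\<dots> \<le> X"
      unfolding X_def by (intro mult_left_mono sum_le_suminf sx) auto
    finally show ?thesis .
  qed
  show summ: "summable (\<lambda>j. K i j * x j)" for i
  proof (rule summableI_nonneg_bounded)
    fix N
    have nn: "0 \<le> (\<Sum>j<N. K i j * x j)" using K x by (intro sum_nonneg) auto
    have "(\<Sum>j<N. K i j * x j) powr p \<le> (\<Sum>i<Suc i. (\<Sum>j<N. K i j * x j) powr p)"
      by (rule member_le_sum) auto
    also have "\<dots> \<le> X" by (rule fin)
    finally have "((\<Sum>j<N. K i j * x j) powr p) powr (1 / p) \<le> X powr (1 / p)"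
      using p by (intro powr_mono2) auto
    then show "(\<Sum>j<N. K i j * x j) \<le> X powr (1 / p)"
      using p nn by (simp add: powr_powr)
  qed (use K x in auto)
  have bd: "(\<Sum>i<M. (\<Sum>j. K i j * x j) powr p) \<le> X" for M
  proof (rule LIMSEQ_le_const2)
    show "(\<lambda>N. \<Sum>i<M. (\<Sum>j<N. K i j * x j) powr p) \<longlonglongrightarrow> (\<Sum>i<M. (\<Sum>j. K i j * x j) powr p)"
      using p K x by (intro tendsto_sum tendsto_powr2 summable_LIMSEQ summ tendsto_const)
         (auto intro!: sum_nonneg always_eventually)
  qed (use fin in auto)
  show s2: "summable (\<lambda>i. (\<Sum>j. K i j * x j) powr p)"
    by (rule summableI_nonneg_bounded[OF _ bd]) auto
  show "(\<Sum>i. (\<Sum>j. K i j * x j) powr p) \<le> C powr p * (\<Sum>j. x j powr p)"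
    using suminf_le_const[OF s2 bd] by (simp add: X_def)
qed

section \<open>The Gamma function and Beta integrals\<close>

text \<open>Convexity of \<open>ln \<circ> Gamma\<close> with weights \<open>1 / p\<close> and
  \<open>1 - 1 / p\<close>, multiplied by \<open>p\<close> and exponentiated. Below,
  \<open>x\<close> and \<open>y\<close> are chosen so that the mean is an integer or
  \<open>n + s\<close>.\<close>

lemma Gamma_log_convex_powr:
  fixes x y p :: real
  assumes "0 < x" "0 < y" "1 < p"
  shows "Gamma (x / p + (1 - 1 / p) * y) powr p \<le> Gamma x * Gamma y powr (p - 1)"
proof -
  let ?z = "x / p + (1 - 1 / p) * y"
  have z: "0 < ?z" using assms by (intro add_pos_pos mult_pos_pos) auto
  have "(ln \<circ> Gamma) ((1 - (1 - 1/p)) *\<^sub>R x + (1 - 1/p) *\<^sub>R y)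
      \<le> (1 - (1 - 1/p)) * (ln \<circ> Gamma) x + (1 - 1/p) * (ln \<circ> Gamma) y"
    using assms by (intro convex_onD[OF log_convex_Gamma_real]) auto
  then have "ln (Gamma ?z) \<le> ln (Gamma x) / p + (1 - 1/p) * ln (Gamma y)"
    by simp
  then have "p * ln (Gamma ?z) \<le> p * (ln (Gamma x) / p + (1 - 1/p) * ln (Gamma y))"
    using assms by (intro mult_left_mono) auto
  also have "\<dots> = ln (Gamma x) + (p - 1) * ln (Gamma y)"
    using assms by (simp add: field_simps)
  finally have "exp (p * ln (Gamma ?z)) \<le> exp (ln (Gamma x) + (p - 1) * ln (Gamma y))"
    by simp
  then show ?thesis
    using assms z Gamma_real_pos[of x] Gamma_real_pos[of y] Gamma_real_pos[of ?z]
    by (simp add: powr_def exp_add less_imp_neq[THEN not_sym])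
qed

text \<open>At integers both sides are 0, by the conventions for poles of \<open>Gamma\<close> and
  for division by zero.\<close>

lemma Gamma_reflection_real:
  fixes x :: real
  shows "Gamma x * Gamma (1 - x) = pi / sin (pi * x)"
proof -
  have "complex_of_real (Gamma x * Gamma (1 - x)) = complex_of_real (pi / sin (pi * x))"
    using Gamma_reflection_complex[of "complex_of_real x"]
      Gamma_complex_of_real[of x] Gamma_complex_of_real[of "1 - x"] sin_of_real[of "pi * x", where 'a = complex]
    by simp
  then show ?thesis by (simp only: of_real_eq_iff)
qed

text \<open>The weight \<open>u\<^sub>s\<close>. As a finite product over a factorial it is visibly
  continuous in \<open>s\<close> and at most 1 for \<open>0 < s\<close> and
  \<open>s \<le> 1\<close>; the quotient of \<open>Gamma\<close> values is recovered in
  \<open>negbinom_Gamma\<close>.\<close>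

definition negbinom :: "real \<Rightarrow> nat \<Rightarrow> real" where
  "negbinom s n = pochhammer s n / fact n"

lemma negbinom_pos: "0 < s \<Longrightarrow> 0 < negbinom s n"
  by (simp add: negbinom_def pochhammer_pos)

lemma negbinom_Gamma:
  assumes "0 < s"
  shows "negbinom s n = Gamma (real n + s) / (Gamma s * fact n)"
proof -
  have "s \<notin> \<int>\<^sub>\<le>\<^sub>0" using assms by (auto elim!: nonpos_Ints_cases)
  then show ?thesis by (simp add: negbinom_def pochhammer_Gamma add.commute)
qed

lemma negbinom_sums:
  assumes "0 \<le> t" "t < 1"
  shows "(\<lambda>n. negbinom s n * t ^ n) sums ((1 - t) powr (- s))"
proof -
  have "(\<lambda>n. (- s gchoose n) * (- t) ^ n) sums ((1 + - t) powr (- s))"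
    using assms by (intro gen_binomial_real) auto
  moreover have "(- s gchoose n) * (- t) ^ n = negbinom s n * t ^ n" for n
    using minus_one_power_iff[of n, where 'a = real]
    by (simp add: gbinomial_pochhammer negbinom_def power_minus[of t] split: if_splits)
  ultimately show ?thesis by simp
qed

lemma has_integral_power_01: "((\<lambda>t::real. t ^ n) has_integral 1 / real (n + 1)) {0<..<1}"
proof -
  have "((\<lambda>t::real. t ^ n) has_integral (1 ^ Suc n / real (Suc n) - 0 ^ Suc n / real (Suc n))) {0..1}"
    by (intro fundamental_theorem_of_calculus)
       (auto intro!: derivative_eq_intros simp: has_real_derivative_iff_has_vector_derivative[symmetric]
         simp del: power_Suc of_nat_Suc)
  then show ?thesis
    by (simp add: has_integral_Icc_iff_Ioo add.commute)
qed

lemma has_integral_power_Beta: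
  assumes "s < 1"
  shows "((\<lambda>t. t ^ m * (1 - t) powr (- s)) has_integral Beta (real m + 1) (1 - s)) {0<..<1}"
proof -
  have "((\<lambda>t. t powr real m * (1 - t) powr (- s)) has_integral Beta (real m + 1) (1 - s)) {0..1}"
    using has_integral_Beta_real[of "real m + 1" "1 - s"] assms by simp
  \<comment> \<open>The endpoint 0 is dropped before \<open>powr\<close> becomes a power: for
    \<open>m = 0\<close> the two differ there, as \<open>0 powr 0 = 0\<close>.\<close>
  then have "((\<lambda>t. t powr real m * (1 - t) powr (- s)) has_integral Beta (real m + 1) (1 - s)) {0<..<1}"
    by (simp add: has_integral_Icc_iff_Ioo)
  then show ?thesis
    by (rule has_integral_eq[rotated]) (auto simp: powr_realpow)
qed

text \<open>Here \<open>1 / (m + n + 1)\<close> is the integral of \<open>t ^ (m + n)\<close>, and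
  summing under the integral turns the weights into \<open>(1 - t) powr (- s)\<close>. All terms are
  nonnegative, so the Beta integral bounds the partial sums and monotone convergence identifies
  their limit.\<close>

lemma negbinom_hilbert_sums:
  assumes s: "0 < s" "s < 1"
  shows "(\<lambda>n. negbinom s n / real (m + n + 1)) sums Beta (real m + 1) (1 - s)"
proof -
  let ?f = "\<lambda>N t. \<Sum>n<N. negbinom s n * t ^ (m + n)"
  let ?g = "\<lambda>t. t ^ m * (1 - t) powr (- s)"
  let ?x = "\<lambda>N. \<Sum>n<N. negbinom s n / real (m + n + 1)"
  have f: "(?f N has_integral ?x N) {0<..<1}" for N
  proof (intro has_integral_sum)
    fix n
    from has_integral_mult_right[OF has_integral_power_01[of "m + n"], of "negbinom s n"]
    show "((\<lambda>t. negbinom s n * t ^ (m + n)) has_integral negbinom s n / real (m + n + 1)) {0<..<1}"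
      by simp
  qed auto
  have lim: "(\<lambda>N. ?f N t) \<longlonglongrightarrow> ?g t" if "t \<in> {0<..<1}" for t
    using sums_mult[OF negbinom_sums[of t s], of "t ^ m"] that
    by (simp add: sums_def power_add mult_ac sum_distrib_left)
  have nn: "0 \<le> negbinom s n" for n using negbinom_pos[OF s(1), of n] by simp
  have g: "(?g has_integral Beta (real m + 1) (1 - s)) {0<..<1}"
    by (rule has_integral_power_Beta[OF s(2)])
  have le: "?x N \<le> Beta (real m + 1) (1 - s)" for N
  proof (rule has_integral_le[OF f g])
    fix t :: real assume t: "t \<in> {0<..<1}"
    show "?f N t \<le> ?g t"
      by (rule LIMSEQ_le_const[OF lim[OF t]])
         (use t nn in \<open>auto intro!: exI[of _ N] sum_mono2 mult_nonneg_nonneg\<close>)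
  qed
  have summ: "summable (\<lambda>n. negbinom s n / real (m + n + 1))"
    by (rule summableI_nonneg_bounded[OF _ le]) (simp add: nn)
  have "(?g has_integral (\<Sum>n. negbinom s n / real (m + n + 1))) {0<..<1}"
  proof (rule has_integral_monotone_convergence_increasing[OF f])
    show "?f k t \<le> ?f (Suc k) t" if "t \<in> {0<..<1}" for k t
      using that nn[of k] by simp
    show "(\<lambda>k. ?f k t) \<longlonglongrightarrow> ?g t" if "t \<in> {0<..<1}" for t
      by (rule lim[OF that])
    show "?x \<longlonglongrightarrow> (\<Sum>n. negbinom s n / real (m + n + 1))"
      by (rule summable_LIMSEQ[OF summ])
  qed
  then have "(\<Sum>n. negbinom s n / real (m + n + 1)) = Beta (real m + 1) (1 - s)"
    using g by (rule has_integral_unique)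
  then show ?thesis using summ by (simp add: sums_iff)
qed

lemma Beta_real_nat:
  "Beta (real m + 1) (1 - s) = fact m * Gamma (1 - s) / Gamma (real m + 2 - s)"
  using Gamma_fact[of m, where 'a = real] by (simp add: Beta_def algebra_simps)

lemma Gamma_mult_Gamma_reflected:
  fixes p :: real
  assumes "1 < p"
  shows "Gamma (1 / p) * Gamma (1 - 1 / p) = pi / sin (pi / p)"
  using Gamma_reflection_real[of "1 / p"] by simp

section \<open>Hilbert's inequality with the sharp constant\<close>

text \<open>Schur's test for the kernel \<open>1 / (i + j + 1)\<close> with
  \<open>A = u\<^sub>a\<close>, \<open>a = 1 - 1 / p\<close>. Row sums are Beta integrals; for the
  columns, log-convexity replaces \<open>B powr (p - 1)\<close> by a multiple of
  \<open>u\<^sub>1\<^sub>/\<^sub>p\<close>, whose column sums are again Beta integrals, and compares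
  these with \<open>A powr (p - 1)\<close>.\<close>

lemma
  fixes p :: real and x :: "nat \<Rightarrow> real"
  assumes p: "1 < p" and x: "\<And>j. 0 \<le> x j" and sx: "summable (\<lambda>j. x j powr p)"
  shows hilbert_row_summable: "summable (\<lambda>j. x j / real (i + j + 1))"
    and hilbert_summable_powr: "summable (\<lambda>i. (\<Sum>j. x j / real (i + j + 1)) powr p)"
    and hilbert_inequality:
      "(\<Sum>i. (\<Sum>j. x j / real (i + j + 1)) powr p) \<le> (pi / sin (pi / p)) powr p * (\<Sum>j. x j powr p)"
proof -
  define a where "a = 1 - 1 / p"
  have a: "0 < a" "a < 1" "1 - a = 1 / p" using p by (auto simp: a_def)
  have b: "0 < 1 / p" "1 / p < 1" "1 - 1 / p = a" using p by (auto simp: a_def)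
  note Gpos = Gamma_real_pos[OF a(1)] Gamma_real_pos[OF b(1)]
  define C where "C = Gamma (1 / p) * Gamma a"
  have C0: "0 < C" using Gpos by (simp add: C_def)
  have C: "C = pi / sin (pi / p)" using Gamma_mult_Gamma_reflected[OF p] by (simp add: C_def a_def)
  define A where "A = negbinom a"
  \<comment> \<open>Chosen so that the full row sum equals \<open>C * B m\<close>: it is the Beta
    integral divided by \<open>C\<close>.\<close>
  define B where "B m = fact m / (Gamma a * Gamma (real m + 1 + 1 / p))" for m
  define K where "K i j = 1 / real (i + j + 1)" for i j
  have B0: "0 < B m" for m
    using p Gpos by (auto simp: B_def intro!: divide_pos_pos mult_pos_pos Gamma_real_pos add_nonneg_pos)
  have row: "(\<Sum>j<N. K i j * A j) \<le> C * B i" for i N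
  proof -
    have e: "real i + 2 - a = real i + 1 + 1 / p" by (simp add: a_def)
    have *: "(\<lambda>j. K i j * A j) sums (C * B i)"
      using negbinom_hilbert_sums[OF a(1,2), of i] Gpos unfolding Beta_real_nat unfolding e a(3)
      by (simp add: K_def A_def C_def B_def mult_ac)
    have "(\<Sum>j<N. K i j * A j) \<le> (\<Sum>j. K i j * A j)"
      using negbinom_pos[OF a(1)]
      by (intro sum_le_suminf sums_summable[OF *]) (auto simp: K_def A_def less_imp_le)
    then show ?thesis using sums_unique[OF *] by simp
  qed
  have Bp: "B m powr (p - 1) \<le> Gamma (1 / p) * Gamma a powr (1 - p) * negbinom (1 / p) m" for m
  proof -
    have z: "0 < real m + 1 / p" "0 < real m + 1 + 1 / p" using p by (auto intro!: add_nonneg_pos)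
    \<comment> \<open>The integer \<open>m + 1\<close> is the weighted mean of two points at
      distance 1, so log-convexity bounds \<open>fact m powr p\<close>.\<close>
    have "(real m + 1 / p) / p + (1 - 1 / p) * (real m + 1 + 1 / p) = real m + 1"
      using p by (simp add: field_simps)
    with Gamma_log_convex_powr[OF z p] Gamma_fact[of m, where 'a = real]
    have "fact m powr p \<le> Gamma (real m + 1 / p) * Gamma (real m + 1 + 1 / p) powr (p - 1)"
      by (simp add: add.commute)
    moreover have "(fact m :: real) powr p = fact m * fact m powr (p - 1)"
      using powr_mult_base[of "fact m :: real" "p - 1"] by simp
    moreover have e: "Gamma a powr (1 - p) = 1 / Gamma a powr (p - 1)"
      by (metis minus_diff_eq powr_minus_divide)
    ultimately show ?thesis
      unfolding e using Gpos Gamma_real_pos[OF z(1)] Gamma_real_pos[OF z(2)]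
      by (simp add: B_def negbinom_Gamma[OF b(1)] powr_divide powr_mult field_simps)
  qed
  have col: "(\<Sum>i<M. K i j * B i powr (p - 1)) \<le> C * A j powr (p - 1)" for j M
  proof -
    have z: "0 < real j + 1 + a" "0 < real j + a" using a by auto
    \<comment> \<open>The Beta formula again, now with parameter \<open>1 / p\<close>, so that
      \<open>1 - 1 / p = a\<close> takes the place of \<open>1 / p\<close>.\<close>
    have *: "(\<lambda>i. K i j * negbinom (1 / p) i) sums (fact j * Gamma a / Gamma (real j + 1 + a))"
      using negbinom_hilbert_sums[OF b(1,2), of j] unfolding Beta_real_nat
      by (simp add: K_def a_def add_ac algebra_simps)
    have "(\<Sum>i<M. K i j * B i powr (p - 1))
        \<le> (\<Sum>i<M. K i j * (Gamma (1 / p) * Gamma a powr (1 - p) * negbinom (1 / p) i))"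
      by (intro sum_mono mult_left_mono Bp) (simp add: K_def)
    also have "\<dots> = Gamma (1 / p) * Gamma a powr (1 - p) * (\<Sum>i<M. K i j * negbinom (1 / p) i)"
      by (simp add: sum_distrib_left mult_ac)
    also have "\<dots> \<le> Gamma (1 / p) * Gamma a powr (1 - p) * (\<Sum>i. K i j * negbinom (1 / p) i)"
      using negbinom_pos[OF b(1)] Gpos
      by (intro mult_left_mono sum_le_suminf sums_summable[OF *]) (auto simp: K_def less_imp_le)
    also have "\<dots> = C * (Gamma a powr (1 - p) * (fact j / Gamma (real j + 1 + a)))"
      using sums_unique[OF *, symmetric] by (simp add: C_def)
    also have "\<dots> \<le> C * A j powr (p - 1)"
    proof (rule mult_left_mono)
      \<comment> \<open>The same comparison as for \<open>Bp\<close>, with the mean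
        \<open>j + 1\<close> taken between \<open>j + a\<close> and
        \<open>j + 1 + a\<close>.\<close>
      have "(real j + 1 + a) / p + (1 - 1 / p) * (real j + a) = real j + 1"
        using p by (simp add: field_simps a_def)
      with Gamma_log_convex_powr[OF z p] Gamma_fact[of j, where 'a = real]
      have "fact j powr p \<le> Gamma (real j + 1 + a) * Gamma (real j + a) powr (p - 1)"
        by (simp add: add.commute)
      moreover have "(fact j :: real) powr p = fact j * fact j powr (p - 1)"
        using powr_mult_base[of "fact j :: real" "p - 1"] by simp
      moreover have "Gamma a powr (1 - p) = 1 / Gamma a powr (p - 1)"
        by (metis minus_diff_eq powr_minus_divide)
      ultimately show "Gamma a powr (1 - p) * (fact j / Gamma (real j + 1 + a)) \<le> A j powr (p - 1)"
        using Gpos Gamma_real_pos[OF z(1)] Gamma_real_pos[OF z(2)]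
        by (simp add: A_def negbinom_Gamma[OF a(1)] powr_divide powr_mult field_simps)
    qed (use C0 in simp)
    finally show ?thesis .
  qed
  have K0: "0 \<le> K i j" for i j by (simp add: K_def)
  have A0: "0 < A j" for j by (simp add: A_def negbinom_pos a)
  note schur = schur_test[where K = K and A = A and B = B, OF p less_imp_le[OF C0] K0 A0 less_imp_le[OF B0] x sx row col]
  show "summable (\<lambda>j. x j / real (i + j + 1))"
    using schur(1) by (simp add: K_def)
  show "summable (\<lambda>i. (\<Sum>j. x j / real (i + j + 1)) powr p)"
    using schur(2) by (simp add: K_def)
  show "(\<Sum>i. (\<Sum>j. x j / real (i + j + 1)) powr p) \<le> (pi / sin (pi / p)) powr p * (\<Sum>j. x j powr p)"
    using schur(3) unfolding C by (simp add: K_def)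
qed

section \<open>Optimality of the constant\<close>

text \<open>The points \<open>x + s\<close> and \<open>x + 2 - s\<close> lie symmetrically in the
  interval from \<open>x\<close> to \<open>x + 2\<close>. Adding the two convexity estimates for
  \<open>ln \<circ> Gamma\<close>, the weights at each endpoint sum to 1.\<close>

lemma Gamma_mult_le_two_steps:
  fixes x s :: real
  assumes "0 < x" "0 \<le> s" "s \<le> 2"
  shows "Gamma (x + s) * Gamma (x + 2 - s) \<le> Gamma x * Gamma (x + 2)"
proof -
  have *: "ln (Gamma (x + u)) \<le> (1 - u / 2) * ln (Gamma x) + (u / 2) * ln (Gamma (x + 2))"
    if "0 \<le> u" "u \<le> 2" for u
  proof -
    have "(ln \<circ> Gamma) ((1 - u / 2) *\<^sub>R x + (u / 2) *\<^sub>R (x + 2))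
      \<le> (1 - u / 2) * (ln \<circ> Gamma) x + (u / 2) * (ln \<circ> Gamma) (x + 2)"
      using assms that by (intro convex_onD[OF log_convex_Gamma_real]) auto
    moreover have "(1 - u / 2) *\<^sub>R x + (u / 2) *\<^sub>R (x + 2) = x + u" by (simp add: field_simps)
    ultimately show ?thesis by simp
  qed
  have pos: "0 < Gamma (x + s)" "0 < Gamma (x + 2 - s)" "0 < Gamma x" "0 < Gamma (x + 2)"
    using assms by (auto intro!: Gamma_real_pos)
  have "ln (Gamma (x + s) * Gamma (x + 2 - s)) = ln (Gamma (x + s)) + ln (Gamma (x + (2 - s)))"
    using pos by (simp add: ln_mult add_diff_eq)
  also have "\<dots> \<le> (1 - s / 2) * ln (Gamma x) + (s / 2) * ln (Gamma (x + 2))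
      + ((1 - (2 - s) / 2) * ln (Gamma x) + ((2 - s) / 2) * ln (Gamma (x + 2)))"
    using assms by (intro add_mono *) auto
  also have "\<dots> = ln (Gamma x) + ln (Gamma (x + 2))" by (simp add: field_simps)
  also have "\<dots> = ln (Gamma x * Gamma (x + 2))" using pos by (simp add: ln_mult)
  finally show ?thesis using pos by simp
qed

text \<open>The preceding inequality at \<open>x = m\<close>, where
  \<open>Gamma m * Gamma (m + 2)\<close> is \<open>(fact m)\<^sup>2 * (m + 1) / m\<close>. This is
  the source of the factor \<open>m / (m + 1)\<close>, and \<open>0 < m\<close> keeps
  \<open>x\<close> away from the pole at 0.\<close>

lemma Beta_ge_negbinom:
  assumes s: "0 < s" "s < 1" and m: "0 < m"
  shows "Gamma s * Gamma (1 - s) * (real m / real (m + 1)) * negbinom s m \<le> Beta (real m + 1) (1 - s)"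
proof -
  have pos: "0 < Gamma (real m + s)" "0 < Gamma (real m + 2 - s)" "0 < Gamma s" "0 < Gamma (1 - s)"
    using s by (auto intro!: Gamma_real_pos)
  have "Gamma (real m) = fact m / real m"
    using m Gamma_fact[of "m - 1", where 'a = real] by (simp add: of_nat_diff fact_reduce[of m])
  moreover have "Gamma (real m + 2) = fact m * (real m + 1)"
    using Gamma_fact[of "m + 1", where 'a = real] by (simp add: algebra_simps)
  ultimately have "Gamma (real m + s) * Gamma (real m + 2 - s) \<le> fact m / real m * (fact m * (real m + 1))"
    using Gamma_mult_le_two_steps[of "real m" s] s m by simp
  then have "real m * Gamma (real m + s) * Gamma (real m + 2 - s) \<le> fact m * (real (m + 1) * fact m)"
    using m by (simp add: field_simps)
  then have "real m * Gamma (real m + s) / (real (m + 1) * fact m) \<le> fact m / Gamma (real m + 2 - s)"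
    using pos(2) by (subst pos_le_divide_eq, simp, subst times_divide_eq_left, subst pos_divide_le_eq) auto
  then have "(real m / real (m + 1)) * Gamma (real m + s) / fact m \<le> fact m / Gamma (real m + 2 - s)"
    by simp
  then have "Gamma (1 - s) * ((real m / real (m + 1)) * Gamma (real m + s) / fact m) \<le> Gamma (1 - s) * (fact m / Gamma (real m + 2 - s))"
    using pos by (intro mult_left_mono) auto
  then show ?thesis
    using pos by (simp add: negbinom_Gamma[OF s(1)] Beta_real_nat mult_ac)
qed

lemma negbinom_le_one:
  assumes "0 < s" "s \<le> 1"
  shows "negbinom s n \<le> 1"
proof -
  have "pochhammer s n \<le> pochhammer 1 n"
    unfolding pochhammer_prod using assms by (intro prod_mono) auto
  then show ?thesis by (simp add: negbinom_def flip: pochhammer_fact)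
qed

text \<open>Log-convexity gives \<open>u\<^sub>s(n) \<le> n powr (s - 1) / Gamma s\<close> for
  \<open>n > 0\<close>, and \<open>p * (1 - s) > 1\<close>.\<close>

lemma summable_negbinom_powr:
  assumes p: "1 < p" and s: "0 < s" "s < 1 - 1 / p"
  shows "summable (\<lambda>n. negbinom s n powr p)"
proof -
  \<comment> \<open>With this exponent the weights \<open>1 / r\<close> and \<open>1 - 1 / r\<close>
    on \<open>n\<close> and \<open>n + 1\<close> have mean \<open>n + s\<close>.\<close>
  define r where "r = 1 / (1 - s)"
  have "1 / p < 1 - s" using s by simp
  have "s < 1" using s p by (smt (verit) divide_pos_pos)
  have r: "1 < r" "1 / r = 1 - s" "r < p"
    using s p \<open>s < 1\<close> \<open>1 / p < 1 - s\<close> by (auto simp: r_def field_simps)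
  have G: "0 < Gamma s" using s by (intro Gamma_real_pos)
  have bound: "negbinom s n powr p \<le> (1 / Gamma s) powr p * real n powr (- (p / r))" if n: "0 < n" for n
  proof -
    have "real n / r + (1 - 1 / r) * (real n + 1) = real n + s"
      using r(2) by (simp add: divide_inverse algebra_simps)
    then have "Gamma (real n + s) powr r \<le> Gamma (real n) * Gamma (real n + 1) powr (r - 1)"
      using Gamma_log_convex_powr[of "real n" "real n + 1" r] n r by simp
    also have "Gamma (real n) = fact n / real n"
      using n Gamma_fact[of "n - 1", where 'a = real] by (simp add: of_nat_diff fact_reduce[of n])
    also have "Gamma (real n + 1) = fact n"
      using Gamma_fact[of n, where 'a = real] by (simp add: add.commute)
    also have "fact n / real n * fact n powr (r - 1) = fact n powr r / real n"
      using powr_mult_base[of "fact n :: real" "r - 1"] by simp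
    finally have "(Gamma (real n + s) powr r) powr (p / r) \<le> (fact n powr r / real n) powr (p / r)"
      using r p by (intro powr_mono2) auto
    then have "Gamma (real n + s) powr p \<le> fact n powr p * real n powr (- (p / r))"
      using r(1) n by (simp add: powr_powr powr_divide powr_minus_divide)
    then have "Gamma (real n + s) powr p / fact n powr p / Gamma s powr p \<le> real n powr (- (p / r)) / Gamma s powr p"
      by (intro divide_right_mono) (simp_all add: pos_divide_le_eq mult.commute)
    then show ?thesis
      using G s n by (simp add: negbinom_Gamma powr_divide powr_mult Gamma_real_pos less_imp_le mult.commute)
  qed
  have "summable (\<lambda>n. (1 / Gamma s) powr p * real n powr (- (p / r)))"
    using r p by (intro summable_mult) (simp add: summable_real_powr_iff)
  then show ?thesis
    by (rule summable_comparison_test'[where N = 1]) (use bound in auto)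
qed

text \<open>At the critical parameter \<open>a = 1 - 1 / p\<close>, log-convexity around
  \<open>n + 1\<close> bounds the terms from below by the harmonic series, up to the factor
  \<open>Gamma a powr p\<close>.\<close>

lemma not_summable_negbinom_powr:
  assumes p: "1 < p"
  shows "\<not> summable (\<lambda>n. negbinom (1 - 1 / p) n powr p)"
proof
  define a where "a = 1 - 1 / p"
  have a: "0 < a" "a < 1" using p by (auto simp: a_def)
  have G: "0 < Gamma a" using a by (intro Gamma_real_pos)
  assume "summable (\<lambda>n. negbinom (1 - 1 / p) n powr p)"
  then have "summable (\<lambda>n. Gamma a powr p * negbinom a n powr p)"
    unfolding a_def by (rule summable_mult)
  moreover have "norm (1 / real (Suc n)) \<le> Gamma a powr p * negbinom a n powr p" for n
  proof -
    have z: "0 < real n + 1 + a" "0 < real n + a" using a by auto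
    have Gz: "0 < Gamma (real n + a)" using z by (intro Gamma_real_pos)
    have "(real n + 1 + a) / p + (1 - 1 / p) * (real n + a) = real n + 1"
      using p by (simp add: field_simps a_def)
    with Gamma_log_convex_powr[OF z p] Gamma_fact[of n, where 'a = real]
    have "fact n powr p \<le> Gamma (real n + 1 + a) * Gamma (real n + a) powr (p - 1)"
      by (simp add: add.commute)
    also have "Gamma (real n + 1 + a) = (real n + a) * Gamma (real n + a)"
    proof -
      have "real n + a \<notin> \<int>\<^sub>\<le>\<^sub>0" using z by (auto elim!: nonpos_Ints_cases)
      then show ?thesis using Gamma_plus1[of "real n + a"] by (simp add: add_ac)
    qed
    also have "(real n + a) * Gamma (real n + a) * Gamma (real n + a) powr (p - 1)
        = (real n + a) * Gamma (real n + a) powr p"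
      using Gz powr_mult_base[of "Gamma (real n + a)" "p - 1"] by simp
    also have "\<dots> \<le> real (Suc n) * Gamma (real n + a) powr p"
      using a by (intro mult_right_mono) auto
    finally have "1 / real (Suc n) \<le> Gamma (real n + a) powr p / fact n powr p"
      by (simp add: field_simps)
    also have "\<dots> = Gamma a powr p * negbinom a n powr p"
      using G Gz by (simp add: negbinom_Gamma[OF a(1)] powr_divide powr_mult)
    finally show ?thesis by simp
  qed
  ultimately have "summable (\<lambda>n. 1 / real (Suc n))"
    by (rule summable_comparison_test'[where N = 0])
  then show False
    using not_summable_harmonic[where 'a = real] by (subst (asm) summable_Suc_iff) (simp add: inverse_eq_divide)
qed

lemma tendsto_negbinom: "((\<lambda>s. negbinom s n) \<longlongrightarrow> negbinom a n) (at a within S)"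
  unfolding negbinom_def pochhammer_prod by (intro tendsto_intros) auto

text \<open>If \<open>N\<close> were smaller, then testing on \<open>u\<^sub>s\<close> with
  \<open>s < a\<close> would bound the sum of \<open>u\<^sub>s(m) powr p\<close> by a quantity that
  stays finite as \<open>s\<close> increases to \<open>a\<close>. The partial sums at
  \<open>a\<close> would inherit the bound, against the divergence just shown.\<close>

lemma hilbert_constant_optimal:
  fixes p N :: real
  assumes p: "1 < p" and "0 \<le> N"
    and bound: "\<And>x. (\<And>j. 0 \<le> x j) \<Longrightarrow> summable (\<lambda>j. x j powr p) \<Longrightarrow>
      (\<Sum>i. (\<Sum>j. x j / real (i + j + 1)) powr p) \<le> N powr p * (\<Sum>j. x j powr p)"
  shows "pi / sin (pi / p) \<le> N"
proof (rule ccontr)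
  assume "\<not> pi / sin (pi / p) \<le> N"
  define a where "a = 1 - 1 / p"
  have a: "0 < a" "a < 1" using p by (auto simp: a_def)
  define C where "C s = Gamma s * Gamma (1 - s)" for s :: real
  have "C a = pi / sin (pi / p)"
    using Gamma_mult_Gamma_reflected[OF p] by (simp add: C_def a_def mult.commute)
  then have NC: "N < C a" using \<open>\<not> _\<close> by simp
  have C0: "0 < C s" if "0 < s" "s < 1" for s
    using that by (simp add: C_def Gamma_real_pos)
  have "(\<lambda>M. C a * (real M / real (M + 1))) \<longlonglongrightarrow> C a * 1"
    using LIMSEQ_n_over_Suc_n[where 'a = real] by (intro tendsto_intros) simp
  then have "\<forall>\<^sub>F M in sequentially. N < C a * (real M / real (M + 1))"
    using NC by (intro order_tendstoD) auto
  \<comment> \<open>A cut-off independent of \<open>s\<close>: from \<open>M\<close> on,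
    \<open>m / (m + 1)\<close> is at least its value \<open>c\<close> at \<open>M\<close>, and
    \<open>C a * c\<close> still exceeds \<open>N\<close>.\<close>
  then obtain M where M: "N < C a * (real M / real (M + 1))"
    by (meson eventually_happens trivial_limit_sequentially)
  define c where "c = real M / real (M + 1)"
  have "0 < M" using M \<open>0 \<le> N\<close> by (cases M) auto
  then have c: "0 < c" by (simp add: c_def)
  have nn: "0 \<le> negbinom s m" if "0 < s" for s m using negbinom_pos[OF that, of m] by simp
  have key: "(C s * c) powr p * (\<Sum>m. negbinom s m powr p)
      \<le> N powr p * (\<Sum>m. negbinom s m powr p) + real M * (C s * c) powr p"
    if s: "0 < s" "s < a" for s
  proof -
    have s1: "s < 1" and s2: "s < 1 - 1 / p" using s a(2) by (auto simp: a_def[symmetric])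
    note sf = summable_negbinom_powr[OF p s(1) s2]
    define g where "g m = Beta (real m + 1) (1 - s)" for m
    have g: "(\<Sum>j. negbinom s j / real (i + j + 1)) = g i" for i
      using sums_unique[OF negbinom_hilbert_sums[OF s(1) s1]] by (simp add: g_def)
    have sg: "summable (\<lambda>m. g m powr p)"
      using hilbert_summable_powr[OF p nn[OF s(1)] sf] by (simp only: g)
    have gb: "(\<Sum>m. g m powr p) \<le> N powr p * (\<Sum>m. negbinom s m powr p)"
      using bound[OF nn[OF s(1)] sf] by (simp only: g)
    \<comment> \<open>The first \<open>M\<close> terms are only estimated through
      \<open>negbinom s m \<le> 1\<close>, which costs a bounded amount; the others obey
      \<open>Beta_ge_negbinom\<close>.\<close>
    have pt: "(C s * c) powr p * negbinom s m powr p \<le> g m powr p + (if m < M then (C s * c) powr p else 0)" for m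
    proof (cases "m < M")
      case True
      have "negbinom s m powr p \<le> 1 powr p"
        using p s s1 by (intro powr_mono2 negbinom_le_one nn) auto
      then have "(C s * c) powr p * negbinom s m powr p \<le> (C s * c) powr p * 1"
        by (intro mult_left_mono) auto
      also have "\<dots> \<le> g m powr p + (C s * c) powr p" by simp
      finally show ?thesis using True by simp
    next
      case False
      with \<open>0 < M\<close> have m: "0 < m" by simp
      have "c \<le> real m / real (m + 1)"
        using False by (simp add: c_def field_simps)
      then have "C s * c * negbinom s m \<le> C s * (real m / real (m + 1)) * negbinom s m"
        using C0[of s] s s1 nn[of s m] by (intro mult_left_mono mult_right_mono) auto
      also have "\<dots> \<le> g m"
        using Beta_ge_negbinom[OF s(1) s1 m] by (simp add: C_def g_def)
      finally have "(C s * c * negbinom s m) powr p \<le> g m powr p"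
        using C0[of s] s s1 c p nn[of s m] by (intro powr_mono2) auto
      then show ?thesis
        using False C0[of s] s s1 c nn[of s m] by (simp add: powr_mult)
    qed
    have fin: "(\<lambda>m. if m < M then (C s * c) powr p else 0) sums (\<Sum>m<M. (C s * c) powr p)"
      using sums_If_finite_set[of "{..<M}" "\<lambda>_. (C s * c) powr p"] by simp
    have "(C s * c) powr p * (\<Sum>m. negbinom s m powr p) = (\<Sum>m. (C s * c) powr p * negbinom s m powr p)"
      by (rule suminf_mult[OF sf, symmetric])
    also have "\<dots> \<le> (\<Sum>m. g m powr p + (if m < M then (C s * c) powr p else 0))"
      by (intro suminf_le pt summable_mult sf summable_add sg sums_summable[OF fin])
    also have "\<dots> = (\<Sum>m. g m powr p) + real M * (C s * c) powr p"
      using suminf_add[OF sg sums_summable[OF fin]] sums_unique[OF fin] by simp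
    finally show ?thesis using gb by simp
  qed
  have lim: "((\<lambda>s. (C s * c) powr p) \<longlongrightarrow> (C a * c) powr p) (at_left a)"
  proof -
    have "1 - a > 0" using a by simp
    then have "a \<notin> \<int>\<^sub>\<le>\<^sub>0" "1 - a \<notin> \<int>\<^sub>\<le>\<^sub>0"
      using a by (auto elim!: nonpos_Ints_cases)
    then have "(C \<longlongrightarrow> C a) (at_left a)"
      unfolding C_def by (intro tendsto_intros) auto
    then show ?thesis
      using C0[OF a] c p by (intro tendsto_powr tendsto_mult tendsto_const) auto
  qed
  have ev: "\<forall>\<^sub>F s in at_left a. 0 < s \<and> s < a"
    using a eventually_at_left_real[of 0 a] by simp
  have NCc: "N powr p < (C a * c) powr p"
    using M p \<open>0 \<le> N\<close> by (intro powr_less_mono2) (auto simp: c_def)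
  \<comment> \<open>The sum is truncated at a fixed \<open>k\<close> before \<open>s\<close> tends
    to \<open>a\<close>, because the full series diverges at \<open>a\<close>.\<close>
  have "((C a * c) powr p - N powr p) * (\<Sum>m<k. negbinom a m powr p) \<le> real M * (C a * c) powr p" for k
  proof (rule tendsto_le)
    show "((\<lambda>s. ((C s * c) powr p - N powr p) * (\<Sum>m<k. negbinom s m powr p))
        \<longlongrightarrow> ((C a * c) powr p - N powr p) * (\<Sum>m<k. negbinom a m powr p)) (at_left a)"
      using negbinom_pos[OF a(1)]
      by (intro tendsto_intros lim tendsto_negbinom) (auto simp: less_imp_neq[THEN not_sym])
    show "((\<lambda>s. real M * (C s * c) powr p) \<longlongrightarrow> real M * (C a * c) powr p) (at_left a)"
      by (intro tendsto_intros lim)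
    have "\<forall>\<^sub>F s in at_left a. N powr p < (C s * c) powr p"
      by (rule order_tendstoD(1)[OF lim NCc])
    with ev show "\<forall>\<^sub>F s in at_left a. ((C s * c) powr p - N powr p) * (\<Sum>m<k. negbinom s m powr p)
        \<le> real M * (C s * c) powr p"
    proof eventually_elim
      case (elim s)
      then have s2: "s < 1 - 1 / p" by (simp add: a_def)
      have "(\<Sum>m<k. negbinom s m powr p) \<le> (\<Sum>m. negbinom s m powr p)"
        using elim s2 by (intro sum_le_suminf summable_negbinom_powr p) auto
      then have "((C s * c) powr p - N powr p) * (\<Sum>m<k. negbinom s m powr p)
          \<le> ((C s * c) powr p - N powr p) * (\<Sum>m. negbinom s m powr p)"
        using elim by (intro mult_left_mono) auto
      also have "\<dots> \<le> real M * (C s * c) powr p"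
        using key[of s] elim by (simp add: algebra_simps)
      finally show ?case .
    qed
  qed auto
  then have "(\<Sum>m<k. negbinom a m powr p) \<le> real M * (C a * c) powr p / ((C a * c) powr p - N powr p)" for k
    using NCc by (simp add: pos_le_divide_eq mult.commute)
  then have "summable (\<lambda>m. negbinom a m powr p)"
    by (intro summableI_nonneg_bounded) auto
  then show False
    using not_summable_negbinom_powr[OF p] by (simp add: a_def)
qed

section \<open>Power series with p-summable coefficients\<close>

lemma taylor_coeff_sums:
  assumes "f holomorphic_on unit_disc" "z \<in> unit_disc"
  shows "(\<lambda>n. taylor_coeff f n * z ^ n) sums f z"
  using holomorphic_power_series[OF assms] by (simp add: taylor_coeff_def fps_expansion_def)

lemma taylor_coeff_unique:
  assumes "\<And>z. z \<in> unit_disc \<Longrightarrow> (\<lambda>n. c n * z ^ n) sums g z"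
  shows "taylor_coeff g n = c n"
proof -
  have "\<forall>\<^sub>F z in nhds 0. (z :: complex) \<in> unit_disc"
    by (intro eventually_nhds_in_open) auto
  then have "g has_fps_expansion Abs_fps c"
    by (intro has_fps_expansionI) (rule eventually_mono, assumption, simp only: fps_nth_Abs_fps assms)
  then show ?thesis by (simp add: taylor_coeff_def fps_expansion_eqI)
qed

lemma lpA_memI:
  assumes "\<And>z. z \<in> unit_disc \<Longrightarrow> (\<lambda>n. c n * z ^ n) sums g z"
    and "\<And>z. z \<notin> unit_disc \<Longrightarrow> g z = 0" and "summable (\<lambda>n. norm (c n) powr p)"
  shows "g \<in> lpA p"
proof -
  have "g holomorphic_on unit_disc"
    by (rule power_series_holomorphic[where a = c]) (simp only: diff_zero assms(1))
  then show ?thesis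
    using assms(2,3) by (simp only: lpA_def mem_Collect_eq taylor_coeff_unique[of c g, OF assms(1)]) simp
qed

lemma lpA_D:
  assumes "f \<in> lpA p"
  shows "f holomorphic_on unit_disc" and "\<And>z. z \<notin> unit_disc \<Longrightarrow> f z = 0"
    and "summable (\<lambda>n. norm (taylor_coeff f n) powr p)"
  using assms by (auto simp: lpA_def)

text \<open>The coefficients tend to 0, hence are eventually at most 1 in modulus, and the geometric
  series dominates.\<close>

lemma summable_norm_power_series:
  fixes c :: "nat \<Rightarrow> complex"
  assumes p: "1 < p" and "summable (\<lambda>n. norm (c n) powr p)" and "norm z < 1"
  shows "summable (\<lambda>n. norm (c n * z ^ n))"
proof -
  have "(\<lambda>n. norm (c n) powr p) \<longlonglongrightarrow> 0" using assms(2) by (rule summable_LIMSEQ_zero)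
  then have "\<forall>\<^sub>F n in sequentially. norm (c n) powr p < 1" by (intro order_tendstoD) auto
  then have "\<forall>\<^sub>F n in sequentially. norm (norm (c n * z ^ n)) \<le> norm z ^ n"
  proof eventually_elim
    case (elim n)
    have "norm (c n) \<le> 1"
    proof (rule ccontr)
      assume "\<not> norm (c n) \<le> 1"
      then have "1 powr p \<le> norm (c n) powr p" using p by (intro powr_mono2) auto
      then show False using elim by simp
    qed
    then show ?case by (simp add: norm_mult norm_power mult_left_le_one_le)
  qed
  then show ?thesis
    using assms(3) by (rule_tac summable_comparison_test_ev[where g = "\<lambda>n. norm z ^ n"])
      (simp_all add: summable_geometric)
qed

lemma taylor_coeff_cmult:
  assumes "f holomorphic_on unit_disc"
  shows "taylor_coeff (\<lambda>z. c * f z) n = c * taylor_coeff f n"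
  by (rule taylor_coeff_unique[where c = "\<lambda>n. c * taylor_coeff f n"])
     (unfold mult.assoc, intro sums_mult taylor_coeff_sums assms)

lemma lpA_cmult:
  assumes "f \<in> lpA p"
  shows "(\<lambda>z. c * f z) \<in> lpA p"
proof (rule lpA_memI[where c = "\<lambda>n. c * taylor_coeff f n"])
  show "(\<lambda>n. c * taylor_coeff f n * z ^ n) sums (c * f z)" if "z \<in> unit_disc" for z
    using sums_mult[OF taylor_coeff_sums[OF lpA_D(1)[OF assms] that], of c] by (simp add: mult.assoc)
  show "summable (\<lambda>n. norm (c * taylor_coeff f n) powr p)"
    using summable_mult[OF lpA_D(3)[OF assms], of "norm c powr p"] by (simp add: norm_mult powr_mult)
qed (use lpA_D(2)[OF assms] in simp)

lemma lpA_norm_nonneg: "0 \<le> lpA_norm p f"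
  by (simp add: lpA_norm_def)

lemma lpA_norm_powr:
  assumes "1 < p" "f \<in> lpA p"
  shows "lpA_norm p f powr p = (\<Sum>n. norm (taylor_coeff f n) powr p)"
  using assms suminf_nonneg[OF lpA_D(3)[OF assms(2)]] by (simp add: lpA_norm_def powr_powr)

lemma lpA_norm_cmult:
  assumes p: "1 < p" and f: "f \<in> lpA p"
  shows "lpA_norm p (\<lambda>z. c * f z) = norm c * lpA_norm p f"
proof -
  have "(\<Sum>n. norm (taylor_coeff (\<lambda>z. c * f z) n) powr p) = norm c powr p * (\<Sum>n. norm (taylor_coeff f n) powr p)"
    using suminf_mult[OF lpA_D(3)[OF f], of "norm c powr p"]
    by (simp add: taylor_coeff_cmult[OF lpA_D(1)[OF f]] norm_mult powr_mult)
  then show ?thesis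
    using p suminf_nonneg[OF lpA_D(3)[OF f]] by (simp add: lpA_norm_def powr_mult powr_powr)
qed

lemma lpA_norm_le:
  assumes p: "1 < p" and f: "f \<in> lpA p" "g \<in> lpA p" and "0 \<le> C"
    and le: "(\<Sum>n. norm (taylor_coeff g n) powr p) \<le> C powr p * (\<Sum>n. norm (taylor_coeff f n) powr p)"
  shows "lpA_norm p g \<le> C * lpA_norm p f"
proof -
  have "lpA_norm p g powr p \<le> (C * lpA_norm p f) powr p"
    using le \<open>0 \<le> C\<close> lpA_norm_nonneg[of p f] by (simp add: lpA_norm_powr[OF p] f powr_mult)
  then show ?thesis
    using p \<open>0 \<le> C\<close> lpA_norm_nonneg[of p f] powr_less_mono2[of p "C * lpA_norm p f" "lpA_norm p g"]
    by fastforce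
qed

lemma std_basis_sums:
  assumes "z \<in> unit_disc"
  shows "(\<lambda>m. of_bool (m = n) * z ^ m) sums std_basis n z"
proof -
  have "(\<lambda>m. of_bool (m = n) * z ^ m) = (\<lambda>m. if m = n then z ^ m else 0)" by auto
  then show ?thesis using assms sums_single[of n "\<lambda>m. z ^ m"] by (simp add: std_basis_def)
qed

lemma taylor_coeff_std_basis: "taylor_coeff (std_basis n) m = of_bool (m = n)"
  by (rule taylor_coeff_unique[where c = "\<lambda>m. of_bool (m = n)"]) (rule std_basis_sums)

lemma std_basis_in_lpA: "std_basis n \<in> lpA p"
proof (rule lpA_memI[where c = "\<lambda>m. of_bool (m = n)"])
  show "summable (\<lambda>m. norm (of_bool (m = n) :: complex) powr p)"
    by (rule summable_finite[of "{n}"]) auto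
qed (simp_all only: std_basis_sums, simp add: std_basis_def)

text \<open>Subtracting the first \<open>N\<close> terms erases exactly the first \<open>N\<close>
  coefficients, so the norm is the \<open>p\<close>-th root of the tail of a convergent series. This
  is the norm convergence that \<open>has_matrix\<close> asks for.\<close>

lemma lpA_norm_taylor_remainder:
  assumes p: "1 < p" and f: "f \<in> lpA p"
  shows "(\<lambda>N. lpA_norm p (\<lambda>z. f z - (\<Sum>m<N. taylor_coeff f m * std_basis m z))) \<longlonglongrightarrow> 0"
proof -
  let ?u = "\<lambda>n. norm (taylor_coeff f n) powr p"
  have coeff: "taylor_coeff (\<lambda>z. f z - (\<Sum>m<N. taylor_coeff f m * std_basis m z)) n
      = (if n < N then 0 else taylor_coeff f n)" for N n
  proof (rule taylor_coeff_unique)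
    fix z :: complex assume z: "z \<in> unit_disc"
    have "(\<lambda>n. if n < N then taylor_coeff f n * z ^ n else 0) sums (\<Sum>m<N. taylor_coeff f m * std_basis m z)"
      using sums_If_finite_set[of "{..<N}" "\<lambda>n. taylor_coeff f n * z ^ n"] z by (simp add: std_basis_def)
    from sums_diff[OF taylor_coeff_sums[OF lpA_D(1)[OF f] z] this]
    show "(\<lambda>n. (if n < N then 0 else taylor_coeff f n) * z ^ n) sums
        (f z - (\<Sum>m<N. taylor_coeff f m * std_basis m z))"
      by (rule sums_cong[THEN iffD1, rotated]) auto
  qed
  have "(\<Sum>n. norm (if n < N then 0 else taylor_coeff f n) powr p) = (\<Sum>n. ?u n) - (\<Sum>n<N. ?u n)" for N
  proof -
    have "(\<lambda>n. if n < N then ?u n else 0) sums (\<Sum>n<N. ?u n)"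
      using sums_If_finite_set[of "{..<N}" ?u] by simp
    from sums_diff[OF summable_sums[OF lpA_D(3)[OF f]] this]
    show ?thesis by (intro sums_unique[symmetric], rule sums_cong[THEN iffD1, rotated]) auto
  qed
  then have eq: "lpA_norm p (\<lambda>z. f z - (\<Sum>m<N. taylor_coeff f m * std_basis m z))
      = ((\<Sum>n. ?u n) - (\<Sum>n<N. ?u n)) powr (1 / p)" for N
    by (simp add: lpA_norm_def coeff)
  have "(\<lambda>N. (\<Sum>n. ?u n) - (\<Sum>n<N. ?u n)) \<longlonglongrightarrow> (\<Sum>n. ?u n) - (\<Sum>n. ?u n)"
    by (intro tendsto_intros summable_LIMSEQ lpA_D(3)[OF f])
  \<comment> \<open>The base tends to 0, where continuity of the root relies on the tails being
    nonnegative and the exponent positive.\<close>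
  then have "(\<lambda>N. ((\<Sum>n. ?u n) - (\<Sum>n<N. ?u n)) powr (1 / p)) \<longlonglongrightarrow> 0 powr (1 / p)"
    using p by (intro tendsto_powr2 tendsto_const)
       (auto intro!: always_eventually sum_le_suminf lpA_D(3)[OF f])
  then show ?thesis unfolding eq by simp
qed

section \<open>The Markov-Stieltjes transform\<close>

lemma
  fixes c :: complex
  shows set_integrable_power_01: "set_integrable lborel {0<..<1} (\<lambda>t. c * of_real t ^ n)"
    and set_integral_power_01: "(LINT t:{0<..<1}|lborel. c * of_real t ^ n) = c / of_nat (n + 1)"
proof -
  have "set_integrable lborel {0..1} (\<lambda>t::real. t ^ n)"
    by (intro borel_integrable_atLeastAtMost') (auto intro!: continuous_intros)
  then have int: "set_integrable lborel {0<..<1} (\<lambda>t::real. t ^ n)"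
    by (rule set_integrable_subset) auto
  have val: "(LINT t:{0<..<1}|lborel. t ^ n) = 1 / real (n + 1)"
    using set_borel_integral_eq_integral(2)[OF int] integral_unique[OF has_integral_power_01] by (rule trans)
  have intc: "set_integrable lborel {0<..<1} (\<lambda>t. complex_of_real (t ^ n))"
    using integrable_of_real[OF int[unfolded set_integrable_def], where 'a = complex]
    by (simp add: set_integrable_def scaleR_conv_of_real)
  then show "set_integrable lborel {0<..<1} (\<lambda>t. c * of_real t ^ n)"
    by simp
  have "(LINT t:{0<..<1}|lborel. complex_of_real (t ^ n)) = complex_of_real (1 / real (n + 1))"
    unfolding val[symmetric] by (rule set_integral_complex_of_real)
  then show "(LINT t:{0<..<1}|lborel. c * of_real t ^ n) = c / of_nat (n + 1)"
    by simp
qed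

text \<open>The sequence defining the Hankel operator: at \<open>k + j + 1\<close> it gives the
  entries of the Hilbert matrix.\<close>

abbreviation (input) reciprocal_seq :: "nat \<Rightarrow> complex" where
  "reciprocal_seq n \<equiv> 1 / of_nat n"

lemma summable_hankel_reciprocal:
  assumes p: "1 < p" and f: "f \<in> lpA p"
  shows "summable (\<lambda>k. norm (taylor_coeff f k) / real (j + k + 1))"
    and "summable (\<lambda>k. norm (reciprocal_seq (k + j + 1) * taylor_coeff f k))"
    and "norm (hankel_coeff reciprocal_seq f j) \<le> (\<Sum>k. norm (taylor_coeff f k) / real (j + k + 1))"
proof -
  show 1: "summable (\<lambda>k. norm (taylor_coeff f k) / real (j + k + 1))"
    by (rule hilbert_row_summable[OF p _ lpA_D(3)[OF f]]) simp
  have e: "norm (reciprocal_seq (k + j + 1) * taylor_coeff f k) = norm (taylor_coeff f k) / real (j + k + 1)" for k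
    by (simp only: norm_mult norm_divide norm_one norm_of_nat) (simp add: add.commute)
  show 2: "summable (\<lambda>k. norm (reciprocal_seq (k + j + 1) * taylor_coeff f k))"
    using 1 unfolding e .
  show "norm (hankel_coeff reciprocal_seq f j) \<le> (\<Sum>k. norm (taylor_coeff f k) / real (j + k + 1))"
    unfolding hankel_coeff_def using summable_norm[OF 2] unfolding e .
qed

text \<open>Term-by-term integration of the Taylor series of \<open>f\<close>, which may be
  unbounded near 1. The integrals of the norms of the terms form a row of the Hilbert matrix applied
  to the moduli of the coefficients, so their summability comes from Hilbert's inequality.\<close>

lemma
  assumes p: "1 < p" and f: "f \<in> lpA p"
  shows set_integrable_lpA_moment:
      "set_integrable lborel {0<..<1} (\<lambda>t. of_real t ^ j * f (of_real t))"
    and set_integral_lpA_moment: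
      "(LINT t:{0<..<1}|lborel. of_real t ^ j * f (of_real t)) = hankel_coeff reciprocal_seq f j"
proof -
  let ?c = "taylor_coeff f"
  define F where "F k t = indicator {0<..<1} t *\<^sub>R (?c k * complex_of_real t ^ (k + j))" for k t
  have intF: "integrable lborel (F k)" for k
    using set_integrable_power_01[of "?c k" "k + j"] by (simp add: set_integrable_def F_def[abs_def])
  have valF: "integral\<^sup>L lborel (F k) = reciprocal_seq (k + j + 1) * ?c k" for k
  proof -
    have "integral\<^sup>L lborel (F k) = (LINT t:{0<..<1}|lborel. ?c k * of_real t ^ (k + j))"
      by (simp only: set_lebesgue_integral_def F_def[abs_def])
    also have "\<dots> = ?c k / of_nat (k + j + 1)" by (rule set_integral_power_01)
    finally show ?thesis by simp
  qed
  have normF: "(\<integral>t. norm (F k t) \<partial>lborel) = norm (?c k) / real (j + k + 1)" for k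
  proof -
    \<comment> \<open>The real integral is moved to the complex numbers so that the formula for
      complex power integrals evaluates it.\<close>
    have "complex_of_real (\<integral>t. norm (F k t) \<partial>lborel) = (\<integral>t. complex_of_real (norm (F k t)) \<partial>lborel)"
      by (rule integral_complex_of_real[symmetric])
    also have "\<dots> = (LINT t:{0<..<1}|lborel. of_real (norm (?c k)) * complex_of_real t ^ (k + j))"
      unfolding set_lebesgue_integral_def
      by (intro Bochner_Integration.integral_cong)
         (auto simp: F_def norm_mult norm_power indicator_def)
    also have "\<dots> = complex_of_real (norm (?c k) / real (j + k + 1))"
      by (subst set_integral_power_01) (simp add: add_ac)
    finally show ?thesis by (simp only: of_real_eq_iff)
  qed
  have sums: "(\<lambda>k. F k t) sums (indicator {0<..<1} t *\<^sub>R (of_real t ^ j * f (of_real t)))" for t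
  proof (cases "t \<in> {0<..<1}")
    case True
    have "(\<lambda>k. of_real t ^ j * (?c k * of_real t ^ k)) sums (of_real t ^ j * f (of_real t))"
      by (intro sums_mult taylor_coeff_sums lpA_D(1)[OF f]) (use True in simp)
    then show ?thesis using True by (simp add: F_def power_add mult_ac)
  qed (simp add: F_def)
  have summ: "summable (\<lambda>k. norm (F k t))" for t
  proof (cases "t \<in> {0<..<1}")
    case True
    have "summable (\<lambda>k. t ^ j * norm (?c k * of_real t ^ k))"
      by (intro summable_mult summable_norm_power_series[OF p lpA_D(3)[OF f]]) (use True in simp)
    moreover have "norm (F k t) = t ^ j * norm (?c k * of_real t ^ k)" for k
      using True by (simp add: F_def power_add norm_mult norm_power)
    ultimately show ?thesis by (simp only:)
  qed (simp add: F_def)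
  have summI: "summable (\<lambda>k. \<integral>t. norm (F k t) \<partial>lborel)"
    unfolding normF by (rule summable_hankel_reciprocal(1)[OF p f])
  have eq: "(\<lambda>t. \<Sum>k. F k t) = (\<lambda>t. indicator {0<..<1} t *\<^sub>R (of_real t ^ j * f (of_real t)))"
    using sums by (simp add: sums_iff fun_eq_iff)
  show "set_integrable lborel {0<..<1} (\<lambda>t. of_real t ^ j * f (of_real t))"
    unfolding set_integrable_def eq[symmetric]
    by (rule integrable_suminf[OF intF AE_I2[OF summ] summI])
  show "(LINT t:{0<..<1}|lborel. of_real t ^ j * f (of_real t)) = hankel_coeff reciprocal_seq f j"
    unfolding set_lebesgue_integral_def eq[symmetric] hankel_coeff_def
    by (subst integral_suminf[OF intF AE_I2[OF summ] summI]) (simp only: valF)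
qed

text \<open>The second expansion, of \<open>1 / (1 - t z)\<close> into a geometric series, is kept
  apart from the first. Since \<open>f\<close> is integrable on the interval by the moment lemma at
  \<open>j = 0\<close>, the \<open>j\<close>-th term is dominated in the mean by a constant times
  \<open>norm z ^ j\<close>.\<close>

lemma
  assumes p: "1 < p" and f: "f \<in> lpA p" and z: "z \<in> unit_disc"
  shows set_integrable_markov_stieltjes:
      "set_integrable lborel {0<..<1} (\<lambda>t. f (of_real t) / (1 - of_real t * z))"
    and markov_stieltjes_sums:
      "(\<lambda>j. hankel_coeff reciprocal_seq f j * z ^ j) sums markov_stieltjes f z"
proof -
  define F where "F j t = (indicator {0<..<1} t *\<^sub>R (complex_of_real t ^ j * f (of_real t))) * z ^ j" for j t
  have z1: "norm z < 1" using z by simp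
  have intF: "integrable lborel (F j)" for j
    unfolding F_def using set_integrable_lpA_moment[OF p f, of j] unfolding set_integrable_def by (rule integrable_mult_left)
  have valF: "integral\<^sup>L lborel (F j) = hankel_coeff reciprocal_seq f j * z ^ j" for j
    unfolding F_def set_integral_lpA_moment[OF p f, symmetric] set_lebesgue_integral_def
    by (rule integral_mult_left_zero)
  have tz: "norm (of_real t * z) < 1" if "t \<in> {0<..<1}" for t :: real
  proof -
    have "\<bar>t\<bar> * norm z \<le> 1 * norm z" using that by (intro mult_right_mono) auto
    then show ?thesis using z1 by (simp add: norm_mult)
  qed
  have sums: "(\<lambda>j. F j t) sums (indicator {0<..<1} t *\<^sub>R (f (of_real t) / (1 - of_real t * z)))" for t
  proof (cases "t \<in> {0<..<1}")
    case True
    have "(\<lambda>j. f (of_real t) * (of_real t * z) ^ j) sums (f (of_real t) * (1 / (1 - of_real t * z)))"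
      by (intro sums_mult geometric_sums tz True)
    then show ?thesis using True by (simp add: F_def power_mult_distrib mult_ac)
  qed (simp add: F_def)
  have summ: "summable (\<lambda>j. norm (F j t))" for t
  proof (cases "t \<in> {0<..<1}")
    case True
    have "summable (\<lambda>j. norm (f (of_real t)) * norm (of_real t * z) ^ j)"
      using tz[OF True] by (intro summable_mult summable_geometric) simp
    then show ?thesis using True by (simp add: F_def norm_mult norm_power power_mult_distrib mult_ac)
  qed (simp add: F_def)
  let ?I = "\<integral>t. norm (indicator {0<..<1} t *\<^sub>R f (of_real t)) \<partial>lborel"
  have int0: "integrable lborel (\<lambda>t. indicator {0<..<1} t *\<^sub>R f (of_real t))"
    using set_integrable_lpA_moment[OF p f, of 0] by (simp add: set_integrable_def)
  have normF: "norm (\<integral>t. norm (F j t) \<partial>lborel) \<le> ?I * norm z ^ j" for j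
  proof -
    have "(\<integral>t. norm (F j t) \<partial>lborel) \<le> (\<integral>t. norm (indicator {0<..<1} t *\<^sub>R f (of_real t)) * norm z ^ j \<partial>lborel)"
    proof (intro integral_mono integrable_norm intF integrable_mult_left int0)
      fix t :: real
      have "norm (F j t) = norm (indicator {0<..<1} t *\<^sub>R f (of_real t)) * norm z ^ j * (if t \<in> {0<..<1} then t ^ j else 0)"
        by (simp add: F_def norm_mult norm_power indicator_def)
      also have "\<dots> \<le> norm (indicator {0<..<1} t *\<^sub>R f (of_real t)) * norm z ^ j * 1"
        by (intro mult_left_mono) (auto intro: power_le_one)
      finally show "norm (F j t) \<le> norm (indicator {0<..<1} t *\<^sub>R f (of_real t)) * norm z ^ j" by simp
    qed
    also have "\<dots> = ?I * norm z ^ j" by (rule integral_mult_left_zero)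
    finally show ?thesis by simp
  qed
  have summI: "summable (\<lambda>j. \<integral>t. norm (F j t) \<partial>lborel)"
    by (rule summable_comparison_test'[where N = 0, OF summable_mult[OF summable_geometric] normF]) (simp add: z1)
  have eq: "(\<lambda>t. \<Sum>j. F j t) = (\<lambda>t. indicator {0<..<1} t *\<^sub>R (f (of_real t) / (1 - of_real t * z)))"
    using sums by (simp add: sums_iff fun_eq_iff)
  show "set_integrable lborel {0<..<1} (\<lambda>t. f (of_real t) / (1 - of_real t * z))"
    unfolding set_integrable_def eq[symmetric]
    by (rule integrable_suminf[OF intF AE_I2[OF summ] summI])
  show "(\<lambda>j. hankel_coeff reciprocal_seq f j * z ^ j) sums markov_stieltjes f z"
    using sums_integral[OF intF AE_I2[OF summ] summI] z
    by (simp add: valF eq markov_stieltjes_def set_lebesgue_integral_def)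
qed

lemma taylor_coeff_markov_stieltjes:
  assumes "1 < p" "f \<in> lpA p"
  shows "taylor_coeff (markov_stieltjes f) j = hankel_coeff reciprocal_seq f j"
  by (rule taylor_coeff_unique) (rule markov_stieltjes_sums[OF assms])

text \<open>The Hilbert matrix has positive entries, so the coefficients of the transform are
  dominated by its action on the moduli of the coefficients of \<open>f\<close>, to which Hilbert's
  inequality applies.\<close>

lemma
  assumes p: "1 < p" and f: "f \<in> lpA p"
  shows markov_stieltjes_in_lpA: "markov_stieltjes f \<in> lpA p"
    and lpA_norm_markov_stieltjes_le: "lpA_norm p (markov_stieltjes f) \<le> pi / sin (pi / p) * lpA_norm p f"
proof -
  let ?R = "\<lambda>j. \<Sum>k. norm (taylor_coeff f k) / real (j + k + 1)"
  have le: "norm (hankel_coeff reciprocal_seq f j) powr p \<le> ?R j powr p" for j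
    using p by (intro powr_mono2 summable_hankel_reciprocal(3)[OF p f]) auto
  have sR: "summable (\<lambda>j. ?R j powr p)"
    by (rule hilbert_summable_powr[OF p _ lpA_D(3)[OF f]]) simp
  have sH: "summable (\<lambda>j. norm (hankel_coeff reciprocal_seq f j) powr p)"
    by (rule summable_comparison_test'[where N = 0, OF sR]) (subst real_norm_def, subst abs_of_nonneg, simp, rule le)
  show mem: "markov_stieltjes f \<in> lpA p"
    by (rule lpA_memI[OF markov_stieltjes_sums[OF p f] _ sH]) (simp_all add: markov_stieltjes_def)
  have "(\<Sum>j. norm (taylor_coeff (markov_stieltjes f) j) powr p) \<le> (\<Sum>j. ?R j powr p)"
    unfolding taylor_coeff_markov_stieltjes[OF p f] by (rule suminf_le[OF le sH sR])
  also have "\<dots> \<le> (pi / sin (pi / p)) powr p * (\<Sum>k. norm (taylor_coeff f k) powr p)"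
    by (rule hilbert_inequality[OF p _ lpA_D(3)[OF f]]) simp
  finally show "lpA_norm p (markov_stieltjes f) \<le> pi / sin (pi / p) * lpA_norm p f"
  proof (rule lpA_norm_le[OF p f mem, rotated])
    have "0 < sin (pi / p)"
      using p by (intro sin_gt_zero) (auto simp: field_simps)
    then show "0 \<le> pi / sin (pi / p)" by simp
  qed
qed

lemma markov_stieltjes_add:
  assumes p: "1 < p" and f: "f \<in> lpA p" "g \<in> lpA p"
  shows "markov_stieltjes (\<lambda>z. f z + g z) = (\<lambda>z. markov_stieltjes f z + markov_stieltjes g z)"
proof
  fix z
  show "markov_stieltjes (\<lambda>z. f z + g z) z = markov_stieltjes f z + markov_stieltjes g z"
    using set_integral_add(2)[OF set_integrable_markov_stieltjes[OF p f(1), of z] set_integrable_markov_stieltjes[OF p f(2), of z]]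
    by (simp add: markov_stieltjes_def add_divide_distrib)
qed

lemma markov_stieltjes_cmult: "markov_stieltjes (\<lambda>z. c * f z) = (\<lambda>z. c * markov_stieltjes f z)"
  by (simp add: markov_stieltjes_def fun_eq_iff flip: times_divide_eq_right)

lemma bounded_operator_markov_stieltjes:
  assumes p: "1 < p"
  shows "bounded_operator p markov_stieltjes"
  unfolding bounded_operator_def
  using markov_stieltjes_in_lpA[OF p] markov_stieltjes_add[OF p] markov_stieltjes_cmult
    lpA_norm_markov_stieltjes_le[OF p] by blast

lemma hankel_operator_markov_stieltjes:
  assumes p: "1 < p"
  shows "hankel_operator p markov_stieltjes"
  unfolding hankel_operator_def
\<comment> \<open>\<open>exI\<close> leaves the sequence schematic; the first \<open>show\<close>
  instantiates it to \<open>reciprocal_seq\<close>.\<close>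
proof (intro exI ballI conjI allI)
  fix f j assume f: "f \<in> lpA p"
  show "summable (\<lambda>k. reciprocal_seq (k + j + 1) * taylor_coeff f k)"
    by (rule summable_norm_cancel[OF summable_hankel_reciprocal(2)[OF p f]])
next
  fix f z assume f: "f \<in> lpA p" and z: "z \<in> unit_disc"
  show "summable (\<lambda>j. hankel_coeff reciprocal_seq f j * z ^ j)"
    by (rule sums_summable[OF markov_stieltjes_sums[OF p f z]])
next
  fix f assume f: "f \<in> lpA p"
  show "markov_stieltjes f = hankel_op reciprocal_seq f"
    using sums_unique[OF markov_stieltjes_sums[OF p f]]
    by (auto simp: hankel_op_def markov_stieltjes_def fun_eq_iff)
qed

lemma has_matrix_markov_stieltjes:
  assumes p: "1 < p"
  shows "has_matrix p markov_stieltjes hilbert_matrix"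
  unfolding has_matrix_def
proof
  fix n
  have "hankel_coeff reciprocal_seq (std_basis n) m = hilbert_matrix m n" for m
  proof -
    have "(\<lambda>k. reciprocal_seq (k + m + 1) * taylor_coeff (std_basis n) k)
        = (\<lambda>k. if k = n then reciprocal_seq (k + m + 1) else 0)"
      by (auto simp: taylor_coeff_std_basis)
    then show ?thesis
      using sums_unique[OF sums_single[of n "\<lambda>k. reciprocal_seq (k + m + 1)"]]
      by (simp add: hankel_coeff_def hilbert_matrix_def)
  qed
  then show "(\<lambda>N. lpA_norm p (\<lambda>z. markov_stieltjes (std_basis n) z - (\<Sum>m<N. hilbert_matrix m n * std_basis m z)))
      \<longlonglongrightarrow> 0"
    using lpA_norm_taylor_remainder[OF p markov_stieltjes_in_lpA[OF p std_basis_in_lpA, of n]]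
    by (simp add: taylor_coeff_markov_stieltjes[OF p std_basis_in_lpA])
qed

section \<open>The operator norm\<close>

text \<open>The bound for the transform gives one inequality. For the other, every nonnegative
  \<open>p\<close>-summable sequence is the coefficient sequence of some element of
  \<open>lpA p\<close>, so the operator norm is an admissible constant in Hilbert's inequality and
  optimality applies.\<close>

lemma operator_norm_markov_stieltjes:
  assumes p: "1 < p"
  shows "operator_norm p markov_stieltjes = pi / sin (pi / p)"
proof (rule antisym)
  let ?C = "pi / sin (pi / p)"
  let ?B = "{f \<in> lpA p. lpA_norm p f \<le> 1}"
  let ?N = "operator_norm p markov_stieltjes"
  have "0 < sin (pi / p)"
    using p by (intro sin_gt_zero) (auto simp: field_simps)
  then have C: "0 \<le> ?C" by simp
  \<comment> \<open>The zero function, written as a multiple of a basis element, shows that the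
    supremum is over a nonempty set.\<close>
  have "(\<lambda>z. 0 * std_basis 0 z) \<in> ?B"
    using lpA_cmult[OF std_basis_in_lpA[of 0 p], of 0] lpA_norm_cmult[OF p std_basis_in_lpA, of 0 0]
    by simp
  then have ne: "?B \<noteq> {}" by blast
  have le: "lpA_norm p (markov_stieltjes f) \<le> ?C" if "f \<in> ?B" for f
  proof -
    have "lpA_norm p (markov_stieltjes f) \<le> ?C * lpA_norm p f"
      using that by (intro lpA_norm_markov_stieltjes_le p) auto
    also have "\<dots> \<le> ?C * 1" using that C by (intro mult_left_mono) auto
    finally show ?thesis by simp
  qed
  show "?N \<le> ?C"
    unfolding operator_norm_def by (rule cSUP_least[OF ne le])
  have bdd: "bdd_above ((\<lambda>f. lpA_norm p (markov_stieltjes f)) ` ?B)"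
    using le by (intro bdd_aboveI2)
  have upper: "lpA_norm p (markov_stieltjes f) \<le> ?N" if "f \<in> ?B" for f
    unfolding operator_norm_def using that by (intro cSUP_upper bdd)
  have N0: "0 \<le> ?N"
    using ne upper lpA_norm_nonneg order_trans by blast
  have hom: "lpA_norm p (markov_stieltjes f) \<le> ?N * lpA_norm p f" if f: "f \<in> lpA p" for f
  proof (cases "lpA_norm p f = 0")
    \<comment> \<open>Normalisation is impossible here, but the bound with \<open>?C\<close> already
      makes the left side at most 0.\<close>
    case True
    then show ?thesis using lpA_norm_markov_stieltjes_le[OF p f] by simp
  next
    case False
    define c where "c = complex_of_real (1 / lpA_norm p f)"
    have pos: "0 < lpA_norm p f" using False lpA_norm_nonneg[of p f] by simp
    then have nc: "norm c = 1 / lpA_norm p f" by (simp add: c_def norm_divide)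
    have "(\<lambda>z. c * f z) \<in> ?B"
      using pos by (simp add: lpA_cmult[OF f] lpA_norm_cmult[OF p f] nc)
    then have "lpA_norm p (markov_stieltjes (\<lambda>z. c * f z)) \<le> ?N" by (rule upper)
    then have "norm c * lpA_norm p (markov_stieltjes f) \<le> ?N"
      by (simp add: markov_stieltjes_cmult lpA_norm_cmult[OF p markov_stieltjes_in_lpA[OF p f]])
    then show ?thesis using pos by (simp add: nc field_simps)
  qed
  show "?C \<le> ?N"
  proof (rule hilbert_constant_optimal[OF p N0])
    fix x :: "nat \<Rightarrow> real"
    assume x: "\<And>j. 0 \<le> x j" and sx: "summable (\<lambda>j. x j powr p)"
    define f where "f z = (if z \<in> unit_disc then \<Sum>n. of_real (x n) * z ^ n else 0)" for z :: complex
    have nx: "summable (\<lambda>n. norm (complex_of_real (x n)) powr p)"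
      using sx x by simp
    have fs: "(\<lambda>n. of_real (x n) * z ^ n) sums f z" if "z \<in> unit_disc" for z
      using that summable_norm_cancel[OF summable_norm_power_series[OF p nx, of z]]
      by (simp add: f_def summable_sums)
    have f: "f \<in> lpA p"
      by (rule lpA_memI[OF fs _ nx]) (simp_all add: f_def)
    have cf: "taylor_coeff f n = of_real (x n)" for n
      by (rule taylor_coeff_unique[OF fs])
    \<comment> \<open>Equality holds because every term is nonnegative: no cancellation occurs in
      the series.\<close>
    have row: "norm (hankel_coeff reciprocal_seq f i) = (\<Sum>j. x j / real (i + j + 1))" for i
    proof -
      have s: "summable (\<lambda>j. x j / real (i + j + 1))"
        using hilbert_row_summable[OF p x sx] .
      have "(\<lambda>k. reciprocal_seq (k + i + 1) * taylor_coeff f k) = (\<lambda>k. of_real (x k / real (i + k + 1)))"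
        by (simp add: cf add_ac)
      then have "hankel_coeff reciprocal_seq f i = of_real (\<Sum>j. x j / real (i + j + 1))"
        unfolding hankel_coeff_def using suminf_of_real[OF s, where 'a = complex] by simp
      moreover have "0 \<le> (\<Sum>j. x j / real (i + j + 1))"
        by (rule suminf_nonneg[OF s]) (simp add: x)
      ultimately show ?thesis by (simp only: norm_of_real abs_of_nonneg)
    qed
    have "lpA_norm p (markov_stieltjes f) powr p \<le> (?N * lpA_norm p f) powr p"
      using p by (intro powr_mono2 hom f lpA_norm_nonneg) auto
    then show "(\<Sum>i. (\<Sum>j. x j / real (i + j + 1)) powr p) \<le> ?N powr p * (\<Sum>j. x j powr p)"
      unfolding powr_mult lpA_norm_powr[OF p f] lpA_norm_powr[OF p markov_stieltjes_in_lpA[OF p f]]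
        taylor_coeff_markov_stieltjes[OF p f] row
      by (simp add: cf x)
  qed
qed

theorem theorem5p5:
  fixes p :: real
  assumes "1 < p"
  shows "(\<forall>f\<in>lpA p. \<forall>z\<in>unit_disc.
            set_integrable lborel {0<..<1}
              (\<lambda>t. f (complex_of_real t) / (1 - complex_of_real t * z))) \<and>
         bounded_operator p markov_stieltjes \<and>
         hankel_operator p markov_stieltjes \<and>
         has_matrix p markov_stieltjes hilbert_matrix \<and>
         operator_norm p markov_stieltjes = pi / sin (pi / p)"
  using set_integrable_markov_stieltjes[OF assms] bounded_operator_markov_stieltjes[OF assms]
    hankel_operator_markov_stieltjes[OF assms] has_matrix_markov_stieltjes[OF assms]
    operator_norm_markov_stieltjes[OF assms] by blast

end
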